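(* Let $G$ be a finite weighted graph with vertex set $V$ and graph Laplacian $\mathcal{L}$. If $U\subset V$ is a subset of vertices and $\omega>0$ is such that $$\delta_U\sqrt{\omega}<1,$$ then there exists a set of weights $\mu_u\in\mathbb{R}$, $u\in U$, such that for any $f\in\mathbf{E}_\omega(\mathcal{L})$ the following exact formula holds: $$\sum_{v\in V}f(v)=\sum_{u\in U}f(u)\mu_u .$$
   Context: $G$ is an undirected weighted graph with finite vertex set $V=V(G)$ and symmetric weight function $w:V\times V\to[0,\infty)$, $w(u,v)=w(v,u)$, $w(u,u)=0$; pairs with $w(u,v)\neq0$ are edges. $L_2(G)$ is the space of real-valued functions on $V$ with inner product $\langle f,g\rangle=\sum_{v\in V}f(v)g(v)$. The Laplacian is $(\mathcal{L}f)(v)=\sum_{u\in V}(f(v)-f(u))w(v,u)$, a positive-semidefinite self-adjoint operator on $L_2(G)$. $\mathbf{E}_\omega(\mathcal{L})$ is the span of the eigenvectors of $\mathcal{L}$ whose eigenvalues are $\le\omega$. For $A\subset V$ the vertex boundary $\partial(A)$ is the set of vertices not in $A$ that are joined by an edge to some vertex of $A$, and for $v\in V$ the relative degree is $w_A(v)=\sum_{u\in A}w(u,v)$. Given $U$, define $S_0=U$, $S_1=\partial(S_0)$, $S_2=\partial(S_0\cup S_1)$, ..., $S_n=\partial(S_0\cup\dots\cup S_{n-1})$, where $S_n$ is the last non-empty set obtained; it is assumed that $S_0,\dots,S_n$ form a disjoint cover of $V$. Put $$D_m=\sup_{v\in S_m}w_{S_{m+1}}(v),\qquad K_m=\inf_{v\in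 S_{m+1}}w_{S_m}(v)\qquad(0\le m<n),$$ and $$\delta_U=\left(\sum_{m=1}^n\left(\sum_{k=1}^m\frac1{K_{k-1}}\left(\prod_{i=k}^{m-1}\frac{D_i}{K_i}\right)\right)\right)^{1/2}$$ (empty sums are $0$ and empty products are $1$). *)

theory Defs
  imports "HOL-Analysis.Analysis"
begin

text \<open>
  The vertex set is the whole of a finite type \<open>'v\<close>, and the space of real functions on it,
  with \<open>\<langle>f, g\<rangle> = (\<Sum>v. f v * g v)\<close>, is the Euclidean space \<open>real ^ 'v\<close>.
\<close>

definition weighted_graph :: "('v \<Rightarrow> 'v \<Rightarrow> real) \<Rightarrow> bool" where
  "weighted_graph w \<longleftrightarrow>
     (\<forall>u v. 0 \<le> w u v) \<and> (\<forall>u v. w u v = w v u) \<and> (\<forall>u. w u u = 0)"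

definition laplacian :: "('v::finite \<Rightarrow> 'v \<Rightarrow> real) \<Rightarrow> real ^ 'v \<Rightarrow> real ^ 'v" where
  "laplacian w f = (\<chi> v. \<Sum>u\<in>UNIV. (f $ v - f $ u) * w v u)"

text \<open>Restricting to real eigenvalues loses nothing, as the Laplacian is self-adjoint.\<close>

definition spectral_space :: "('v::finite \<Rightarrow> 'v \<Rightarrow> real) \<Rightarrow> real \<Rightarrow> (real ^ 'v) set" where
  "spectral_space w \<omega> =
     span {f. f \<noteq> 0 \<and> (\<exists>c. c \<le> \<omega> \<and> laplacian w f = c *\<^sub>R f)}"

definition vertex_boundary :: "('v \<Rightarrow> 'v \<Rightarrow> real) \<Rightarrow> 'v set \<Rightarrow> 'v set" where
  "vertex_boundary w A = {v. v \<notin> A \<and> (\<exists>u\<in>A. w u v \<noteq> 0)}"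

definition rel_degree :: "('v \<Rightarrow> 'v \<Rightarrow> real) \<Rightarrow> 'v set \<Rightarrow> 'v \<Rightarrow> real" where
  "rel_degree w A v = (\<Sum>u\<in>A. w u v)"

fun layer :: "('v \<Rightarrow> 'v \<Rightarrow> real) \<Rightarrow> 'v set \<Rightarrow> nat \<Rightarrow> 'v set" where
  "layer w U 0 = U"
| "layer w U (Suc m) = vertex_boundary w (\<Union>i\<in>{..m}. layer w U i)"

text \<open>
  For finite \<open>'v\<close> only finitely many layers are non-empty, since they are pairwise disjoint;
  for \<open>U \<noteq> {}\<close> the maximum is therefore the index of the last non-empty layer.
\<close>

definition last_layer :: "('v \<Rightarrow> 'v \<Rightarrow> real) \<Rightarrow> 'v set \<Rightarrow> nat" where
  "last_layer w U = Max {m. layer w U m \<noteq> {}}"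

definition layers_disjoint_cover :: "('v \<Rightarrow> 'v \<Rightarrow> real) \<Rightarrow> 'v set \<Rightarrow> bool" where
  "layers_disjoint_cover w U \<longleftrightarrow>
     disjoint_family_on (layer w U) {..last_layer w U} \<and>
     (\<Union>m\<in>{..last_layer w U}. layer w U m) = UNIV"

definition D_sup :: "('v \<Rightarrow> 'v \<Rightarrow> real) \<Rightarrow> 'v set \<Rightarrow> nat \<Rightarrow> real" where
  "D_sup w U m = (SUP v\<in>layer w U m. rel_degree w (layer w U (Suc m)) v)"

definition K_inf :: "('v \<Rightarrow> 'v \<Rightarrow> real) \<Rightarrow> 'v set \<Rightarrow> nat \<Rightarrow> real" where
  "K_inf w U m = (INF v\<in>layer w U (Suc m). rel_degree w (layer w U m) v)"

text \<open>\<^const>\<open>D_sup\<close> and \<^const>\<open>K_inf\<close> are used only at indices below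
  \<^const>\<open>last_layer\<close>, where the layers involved are non-empty.\<close>

definition delta :: "('v \<Rightarrow> 'v \<Rightarrow> real) \<Rightarrow> 'v set \<Rightarrow> real" where
  "delta w U =
     sqrt (\<Sum>m = 1..last_layer w U. \<Sum>k = 1..m.
             1 / K_inf w U (k - 1) * (\<Prod>i = k..<m. D_sup w U i / K_inf w U i))"

end

theory Submission
  imports Defs
begin

text \<open>
  The quadrature formula exists as soon as a function of \<open>spectral_space w \<omega>\<close> is determined by
  its values on \<open>U\<close>: restriction to \<open>U\<close> is then injective on a finite-dimensional space, so it
  has a linear left inverse, and the total sum composed with that left inverse is a linear
  functional of the values on \<open>U\<close>. Its coefficients are the weights.

  Injectivity is the conflict between two bounds for the Dirichlet form \<open>\<langle>\<L>f, f\<rangle>\<close>. The Bernstein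
  inequality \<open>laplacian_bernstein\<close> says \<open>\<langle>\<L>f, f\<rangle> \<le> \<omega> \<parallel>f\<parallel>\<^sup>2\<close> for \<open>f\<close> in the spectral space, because
  \<open>f\<close> is a sum of mutually orthogonal eigenvectors with eigenvalues at most \<open>\<omega>\<close>. The Poincare
  inequality \<open>poincare_inequality\<close> says \<open>\<parallel>f\<parallel>\<^sup>2 \<le> \<delta>\<^sup>2 \<langle>\<L>f, f\<rangle>\<close> when \<open>f\<close> vanishes on \<open>U\<close>. Together they
  give \<open>\<parallel>f\<parallel>\<^sup>2 \<le> \<delta>\<^sup>2 \<omega> \<parallel>f\<parallel>\<^sup>2\<close> with \<open>\<delta>\<^sup>2 \<omega> < 1\<close>, hence \<open>f = 0\<close>.

  The Poincare inequality comes from propagating \<open>f\<close> outwards from \<open>U\<close>, one layer at a time.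
  Let \<open>N m\<close> be the norm of \<open>f\<close> on the layer \<open>S m\<close> and \<open>(e m)\<^sup>2\<close> the part of the Dirichlet form
  carried by the edges between \<open>S m\<close> and \<open>S (m + 1)\<close>. The triangle inequality in the space of
  functions on these edges, weighted by \<open>w\<close>, gives
  \<open>\<surd>(K m) * N (m + 1) \<le> \<surd>(D m) * N m + e m\<close>. Solving this recurrence from \<open>N 0 = 0\<close>, applying
  Cauchy-Schwarz, and summing over the layers produces exactly the constant \<open>\<delta>\<^sup>2\<close>.
\<close>

section \<open>The Dirichlet form and the Bernstein inequality\<close>

lemma linear_laplacian: "linear (laplacian w)"
  by (rule linearI)
    (simp_all add: laplacian_def vec_eq_iff sum.distrib [symmetric] sum_distrib_left algebra_simps)

text \<open>Summation by parts: each edge occurs in both orientations, and averaging the two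
  contributions makes the form symmetric in \<open>f\<close> and \<open>g\<close>.\<close>

lemma inner_laplacian:
  assumes "weighted_graph w"
  shows "2 * (laplacian w f \<bullet> g)
    = (\<Sum>v\<in>UNIV. \<Sum>u\<in>UNIV. w v u * (f $ v - f $ u) * (g $ v - g $ u))"
proof -
  have sym: "w u v = w v u" for u v
    using assms by (auto simp: weighted_graph_def)
  let ?S = "\<Sum>v\<in>UNIV. \<Sum>u\<in>UNIV. (f $ v - f $ u) * w v u * g $ v"
  have S: "laplacian w f \<bullet> g = ?S"
    by (simp add: laplacian_def inner_vec_def sum_distrib_right)
  have "?S = (\<Sum>v\<in>UNIV. \<Sum>u\<in>UNIV. (f $ u - f $ v) * w u v * g $ u)"
    by (rule sum.swap)
  then have "2 * (laplacian w f \<bullet> g)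
      = ?S + (\<Sum>v\<in>UNIV. \<Sum>u\<in>UNIV. (f $ u - f $ v) * w u v * g $ u)"
    using S by simp
  also have "\<dots> = (\<Sum>v\<in>UNIV. \<Sum>u\<in>UNIV. w v u * (f $ v - f $ u) * (g $ v - g $ u))"
    unfolding sum.distrib [symmetric]
    by (intro sum.cong refl) (simp add: sym algebra_simps)
  finally show ?thesis .
qed

lemma laplacian_self_adjoint:
  assumes "weighted_graph w"
  shows "laplacian w f \<bullet> g = f \<bullet> laplacian w g"
  using inner_laplacian [OF assms, of f g] inner_laplacian [OF assms, of g f]
  by (simp add: inner_commute mult.commute mult.left_commute)

text \<open>The spanning eigenvectors need not be orthogonal, since an eigenvalue may be multiple.
  Collecting the terms that belong to the same eigenvalue yields a sum of eigenvectors with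
  distinct eigenvalues, and these are orthogonal by self-adjointness.\<close>

lemma laplacian_bernstein:
  assumes w: "weighted_graph w" and f: "f \<in> spectral_space w \<omega>"
  shows "laplacian w f \<bullet> f \<le> \<omega> * (f \<bullet> f)"
proof -
  interpret L: linear "laplacian w" by (rule linear_laplacian)
  obtain t r where t: "finite t"
    "t \<subseteq> {f. f \<noteq> 0 \<and> (\<exists>c. c \<le> \<omega> \<and> laplacian w f = c *\<^sub>R f)}"
    and f_eq: "f = (\<Sum>a\<in>t. r a *\<^sub>R a)"
    using f unfolding spectral_space_def span_explicit by blast
  then have "\<forall>a\<in>t. \<exists>c. c \<le> \<omega> \<and> laplacian w a = c *\<^sub>R a"
    by blast
  then obtain ev where ev: "\<And>a. a \<in> t \<Longrightarrow> ev a \<le> \<omega> \<and> laplacian w a = ev a *\<^sub>R a"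
    by metis
  define C where "C = ev ` t"
  define g where "g c = (\<Sum>a\<in>{a \<in> t. ev a = c}. r a *\<^sub>R a)" for c
  have C: "finite C" "\<And>c. c \<in> C \<Longrightarrow> c \<le> \<omega>"
    using t ev by (auto simp: C_def)
  have f_g: "f = (\<Sum>c\<in>C. g c)"
    unfolding f_eq C_def g_def by (rule sum.image_gen [OF t(1)])
  have Lg: "laplacian w (g c) = c *\<^sub>R g c" for c
    unfolding g_def L.sum scaleR_sum_right
    by (intro sum.cong refl) (auto simp: L.scaleR ev mult.commute)
  have orth: "g c \<bullet> g d = 0" if "c \<noteq> d" for c d
    using laplacian_self_adjoint [OF w, of "g c" "g d"] that by (simp add: Lg)
  have diag: "(\<Sum>c\<in>C. \<Sum>d\<in>C. h c * (g c \<bullet> g d)) = (\<Sum>c\<in>C. h c * (g c \<bullet> g c))"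
    for h :: "real \<Rightarrow> real"
  proof (rule sum.cong [OF refl])
    fix c assume c: "c \<in> C"
    have "(\<Sum>d\<in>C. h c * (g c \<bullet> g d)) = (\<Sum>d\<in>C. if d = c then h c * (g c \<bullet> g c) else 0)"
      by (rule sum.cong) (auto simp: orth)
    then show "(\<Sum>d\<in>C. h c * (g c \<bullet> g d)) = h c * (g c \<bullet> g c)"
      using c C(1) by simp
  qed
  have "laplacian w f \<bullet> f = (\<Sum>c\<in>C. \<Sum>d\<in>C. c * (g c \<bullet> g d))"
    by (subst sum.swap) (simp add: f_g L.sum Lg inner_sum_left inner_sum_right)
  also have "\<dots> = (\<Sum>c\<in>C. c * (g c \<bullet> g c))"
    using diag [of "\<lambda>c. c"] .
  also have "\<dots> \<le> (\<Sum>c\<in>C. \<omega> * (g c \<bullet> g c))"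
    by (intro sum_mono mult_right_mono C) auto
  also have "\<dots> = (\<Sum>c\<in>C. \<Sum>d\<in>C. \<omega> * (g c \<bullet> g d))"
    using diag [of "\<lambda>_. \<omega>"] by simp
  also have "\<dots> = \<omega> * (f \<bullet> f)"
    by (subst sum.swap) (simp add: f_g inner_sum_left inner_sum_right sum_distrib_left)
  finally show ?thesis .
qed

section \<open>The layers around a set of vertices\<close>

lemma layers_disjoint:
  assumes "i \<noteq> j"
  shows "layer w U i \<inter> layer w U j = {}"
proof -
  have "layer w U i \<inter> layer w U j = {}" if "i < j" for i j
    using that by (cases j) (auto simp: vertex_boundary_def)
  then show ?thesis
    using assms by (metis inf_commute linorder_neqE_nat)
qed

lemma finite_nonempty_layers:
  fixes w :: "'v::finite \<Rightarrow> 'v \<Rightarrow> real"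
  shows "finite {m. layer w U m \<noteq> {}}"
proof (rule finite_imageD)
  show "inj_on (layer w U) {m. layer w U m \<noteq> {}}"
    using layers_disjoint [where w = w and U = U] by (force intro!: inj_onI)
qed simp

text \<open>Were all neighbours of \<open>v\<close> in the first \<open>m + 1\<close> layers to lie before \<open>layer w U m\<close>, then
  \<open>v\<close> would have been reached at an earlier stage.\<close>

lemma layer_Suc_neighbour:
  assumes "v \<in> layer w U (Suc m)"
  obtains u where "u \<in> layer w U m" "w u v \<noteq> 0"
proof -
  from assms obtain u i where u: "i \<le> m" "u \<in> layer w U i" "w u v \<noteq> 0"
    and new: "\<And>j. j \<le> m \<Longrightarrow> v \<notin> layer w U j"
    by (auto simp: vertex_boundary_def)
  have "i = m"
  proof (rule ccontr)
    assume "i \<noteq> m"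
    with u have "Suc i \<le> m" by simp
    moreover have "v \<in> layer w U (Suc i)"
      using u new by (auto simp: vertex_boundary_def)
    ultimately show False using new by blast
  qed
  with u that show thesis by blast
qed

text \<open>This is what makes \<open>D_sup\<close> and \<open>K_inf\<close> genuine extrema at all indices below \<open>last_layer\<close>: a
  layer that is not \<open>U\<close> consists of neighbours of its predecessor, so emptiness propagates outwards.\<close>

lemma layer_nonempty:
  fixes w :: "'v::finite \<Rightarrow> 'v \<Rightarrow> real"
  assumes "U \<noteq> {}" "m \<le> last_layer w U"
  shows "layer w U m \<noteq> {}"
proof -
  have "layer w U 0 \<noteq> {}" using assms by simp
  then have "last_layer w U \<in> {m. layer w U m \<noteq> {}}"
    unfolding last_layer_def by (intro Max_in finite_nonempty_layers) blast
  then have "layer w U (last_layer w U) \<noteq> {}" by simp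
  with assms(2) show ?thesis
  proof (induction rule: inc_induct)
    case (step k)
    then show ?case by (metis ex_in_conv layer_Suc_neighbour)
  qed
qed

text \<open>The infimum over the finite set \<open>layer w U (Suc m)\<close> is attained, and every relative degree
  in it is positive because each vertex has a neighbour in the preceding layer.\<close>

lemma K_inf_pos:
  fixes w :: "'v::finite \<Rightarrow> 'v \<Rightarrow> real"
  assumes w: "weighted_graph w" and "layer w U (Suc m) \<noteq> {}"
  shows "0 < K_inf w U m"
proof -
  have nn: "0 \<le> w u v" for u v
    using w by (auto simp: weighted_graph_def)
  let ?A = "rel_degree w (layer w U m) ` layer w U (Suc m)"
  have "K_inf w U m = Min ?A"
    unfolding K_inf_def using assms(2) by (intro cInf_eq_Min) auto
  also have "\<dots> \<in> ?A"
    using assms(2) by (intro Min_in) auto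
  finally obtain v where v: "v \<in> layer w U (Suc m)"
    "K_inf w U m = rel_degree w (layer w U m) v" by auto
  obtain u where "u \<in> layer w U m" "w u v \<noteq> 0"
    using layer_Suc_neighbour [OF v(1)] .
  then have "0 < rel_degree w (layer w U m) v"
    unfolding rel_degree_def by (intro sum_pos2 [of _ u]) (auto simp: nn less_le)
  with v show ?thesis by simp
qed

lemma K_inf_le:
  fixes w :: "'v::finite \<Rightarrow> 'v \<Rightarrow> real"
  assumes "v \<in> layer w U (Suc m)"
  shows "K_inf w U m \<le> rel_degree w (layer w U m) v"
  unfolding K_inf_def using assms by (intro cINF_lower) auto

lemma D_sup_ge:
  fixes w :: "'v::finite \<Rightarrow> 'v \<Rightarrow> real"
  assumes "v \<in> layer w U m"
  shows "rel_degree w (layer w U (Suc m)) v \<le> D_sup w U m"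
  unfolding D_sup_def using assms by (intro cSUP_upper) auto

lemma D_sup_nonneg:
  fixes w :: "'v::finite \<Rightarrow> 'v \<Rightarrow> real"
  assumes "weighted_graph w" "layer w U m \<noteq> {}"
  shows "0 \<le> D_sup w U m"
proof -
  obtain v where "v \<in> layer w U m" using assms by blast
  then have "rel_degree w (layer w U (Suc m)) v \<le> D_sup w U m" by (rule D_sup_ge)
  moreover have "0 \<le> rel_degree w (layer w U (Suc m)) v"
    using assms by (auto simp: rel_degree_def weighted_graph_def intro!: sum_nonneg)
  ultimately show ?thesis by simp
qed

text \<open>The \<open>k\<close>-th coefficient measures how much the energy between layers \<open>k - 1\<close> and \<open>k\<close>
  contributes to the squared norm on layer \<open>m\<close>. The coefficients occur under square roots in
  the Cauchy-Schwarz step.\<close>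

lemma path_coefficient_nonneg:
  fixes w :: "'v::finite \<Rightarrow> 'v \<Rightarrow> real"
  assumes w: "weighted_graph w" and U: "U \<noteq> {}"
    and k: "1 \<le> k" "k \<le> m" and m: "m \<le> last_layer w U"
  shows "0 \<le> 1 / K_inf w U (k - 1) * (\<Prod>i = k..<m. D_sup w U i / K_inf w U i)"
proof -
  have K: "0 \<le> K_inf w U i" if "i < m" for i
    using that m by (intro less_imp_le [OF K_inf_pos] w layer_nonempty U) simp
  have D: "0 \<le> D_sup w U i" if "i < m" for i
    using that m by (intro D_sup_nonneg w layer_nonempty U) simp
  show ?thesis
    using k K D by (intro mult_nonneg_nonneg prod_nonneg) auto
qed

lemma delta_nonneg:
  fixes w :: "'v::finite \<Rightarrow> 'v \<Rightarrow> real"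
  assumes "weighted_graph w" "U \<noteq> {}"
  shows "0 \<le> delta w U"
  unfolding delta_def real_sqrt_ge_0_iff
  by (intro sum_nonneg path_coefficient_nonneg assms) auto

section \<open>The Poincare inequality\<close>

definition layer_energy :: "('v::finite \<Rightarrow> 'v \<Rightarrow> real) \<Rightarrow> 'v set \<Rightarrow> real ^ 'v \<Rightarrow> nat \<Rightarrow> real" where
  "layer_energy w U f m
    = (\<Sum>(u, v)\<in>layer w U m \<times> layer w U (Suc m). w u v * (f $ v - f $ u)\<^sup>2)"

lemma layer_energy_nonneg:
  assumes "weighted_graph w"
  shows "0 \<le> layer_energy w U f m"
  unfolding layer_energy_def using assms by (auto simp: weighted_graph_def intro!: sum_nonneg)

text \<open>The triangle inequality for \<open>f v = f u + (f v - f u)\<close>, over the edges between the two layers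
  with \<open>w\<close> as the weight. Summing out one endpoint turns the first two norms into norms over a
  single layer weighted by relative degrees, which \<open>K_inf\<close> and \<open>D_sup\<close> bound.\<close>

lemma layer_step:
  fixes w :: "'v::finite \<Rightarrow> 'v \<Rightarrow> real"
  assumes w: "weighted_graph w" and ne: "layer w U (Suc m) \<noteq> {}"
  shows "L2_set (($) f) (layer w U (Suc m))
    \<le> sqrt (D_sup w U m / K_inf w U m) * L2_set (($) f) (layer w U m)
      + sqrt (layer_energy w U f m) / sqrt (K_inf w U m)"
proof -
  have nn: "0 \<le> w u v" and sym: "w u v = w v u" for u v
    using w by (auto simp: weighted_graph_def)
  let ?S = "layer w U m" and ?T = "layer w U (Suc m)"
  let ?K = "K_inf w U m" and ?D = "D_sup w U m"
  have K: "0 < ?K" using w ne by (rule K_inf_pos)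
  have "sqrt ?K * L2_set (($) f) ?T = sqrt (\<Sum>v\<in>?T. ?K * (f $ v)\<^sup>2)"
    by (simp add: L2_set_def real_sqrt_mult [symmetric] sum_distrib_left)
  also have "\<dots> \<le> sqrt (\<Sum>v\<in>?T. rel_degree w ?S v * (f $ v)\<^sup>2)"
    by (intro real_sqrt_le_mono sum_mono mult_right_mono K_inf_le) auto
  also have "(\<Sum>v\<in>?T. rel_degree w ?S v * (f $ v)\<^sup>2) = (\<Sum>v\<in>?T. \<Sum>u\<in>?S. w u v * (f $ v)\<^sup>2)"
    by (simp add: rel_degree_def sum_distrib_right)
  also have "\<dots> = (\<Sum>(u, v)\<in>?S \<times> ?T. w u v * (f $ v)\<^sup>2)"
    by (subst sum.swap) (simp add: sum.cartesian_product)
  also have "sqrt \<dots> = L2_set (\<lambda>(u, v). sqrt (w u v) * f $ u + sqrt (w u v) * (f $ v - f $ u)) (?S \<times> ?T)"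
    unfolding L2_set_def
    by (intro arg_cong [of _ _ sqrt] sum.cong refl)
      (auto simp: ring_distribs [symmetric] power_mult_distrib nn)
  also have "\<dots> \<le> L2_set (\<lambda>(u, v). sqrt (w u v) * f $ u) (?S \<times> ?T)
      + L2_set (\<lambda>(u, v). sqrt (w u v) * (f $ v - f $ u)) (?S \<times> ?T)"
    using L2_set_triangle_ineq [of "\<lambda>(u, v). sqrt (w u v) * f $ u"
        "\<lambda>(u, v). sqrt (w u v) * (f $ v - f $ u)" "?S \<times> ?T"]
    by (simp add: case_prod_unfold)
  also have "L2_set (\<lambda>(u, v). sqrt (w u v) * (f $ v - f $ u)) (?S \<times> ?T)
      = sqrt (layer_energy w U f m)"
    unfolding L2_set_def layer_energy_def
    by (intro arg_cong [of _ _ sqrt] sum.cong refl) (auto simp: power_mult_distrib nn)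
  also have "L2_set (\<lambda>(u, v). sqrt (w u v) * f $ u) (?S \<times> ?T)
      = sqrt (\<Sum>(u, v)\<in>?S \<times> ?T. w v u * (f $ u)\<^sup>2)"
    unfolding L2_set_def
    by (intro arg_cong [of _ _ sqrt] sum.cong refl)
      (auto simp: power_mult_distrib nn sym)
  also have "(\<Sum>(u, v)\<in>?S \<times> ?T. w v u * (f $ u)\<^sup>2) = (\<Sum>u\<in>?S. rel_degree w ?T u * (f $ u)\<^sup>2)"
    by (simp add: rel_degree_def sum_distrib_right sum.cartesian_product)
  also have "sqrt \<dots> \<le> sqrt (\<Sum>u\<in>?S. ?D * (f $ u)\<^sup>2)"
    by (intro real_sqrt_le_mono sum_mono mult_right_mono D_sup_ge) auto
  also have "\<dots> = sqrt ?D * L2_set (($) f) ?S"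
    by (simp add: L2_set_def real_sqrt_mult [symmetric] sum_distrib_left)
  finally have "sqrt ?K * L2_set (($) f) ?T
      \<le> sqrt ?D * L2_set (($) f) ?S + sqrt (layer_energy w U f m)"
    by simp
  with K show ?thesis
    by (simp add: real_sqrt_divide field_simps)
qed

lemma sqrt_prod: "sqrt (\<Prod>i\<in>A. f i) = (\<Prod>i\<in>A. sqrt (f i))"
  by (induction A rule: infinite_finite_induct) (simp_all add: real_sqrt_mult)

lemma linear_recurrence_le:
  fixes N a b :: "nat \<Rightarrow> real"
  assumes "N 0 \<le> 0"
    and "\<And>m. m < n \<Longrightarrow> 0 \<le> a m"
    and "\<And>m. m < n \<Longrightarrow> N (Suc m) \<le> a m * N m + b m"
    and "m \<le> n"
  shows "N m \<le> (\<Sum>k = 1..m. b (k - 1) * (\<Prod>i = k..<m. a i))"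
  using \<open>m \<le> n\<close>
proof (induction m)
  case (Suc m)
  have "N (Suc m) \<le> a m * N m + b m"
    using assms Suc by simp
  also have "\<dots> \<le> a m * (\<Sum>k = 1..m. b (k - 1) * (\<Prod>i = k..<m. a i)) + b m"
    using assms Suc by (intro add_right_mono mult_left_mono) auto
  also have "\<dots> = (\<Sum>k = 1..Suc m. b (k - 1) * (\<Prod>i = k..<Suc m. a i))"
    by (simp add: sum_distrib_left mult_ac)
  finally show ?case .
qed (use assms in simp)

text \<open>The products \<open>S k \<times> S (k + 1)\<close> are disjoint from each other and from their converses, so
  together they account for a part of the sum over ordered pairs, in which each edge is
  counted twice.\<close>

lemma sum_layer_energy_le:
  fixes w :: "'v::finite \<Rightarrow> 'v \<Rightarrow> real"
  assumes w: "weighted_graph w"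
  shows "(\<Sum>k<n. layer_energy w U f k) \<le> laplacian w f \<bullet> f"
proof -
  have nn: "0 \<le> w u v" and sym: "w u v = w v u" for u v
    using w by (auto simp: weighted_graph_def)
  have same: "i = j" if "x \<in> layer w U i" "x \<in> layer w U j" for x i j
    using layers_disjoint [of i j w U] that by blast
  let ?q = "\<lambda>(u, v). w u v * (f $ v - f $ u)\<^sup>2"
  define A where "A = (\<Union>k<n. layer w U k \<times> layer w U (Suc k))"
  have A: "(\<Sum>k<n. layer_energy w U f k) = sum ?q A"
    unfolding A_def layer_energy_def
    by (subst sum.UNION_disjoint) (auto dest: same)
  have "A \<inter> prod.swap ` A = {}"
  proof (rule equals0I)
    fix p assume "p \<in> A \<inter> prod.swap ` A"
    then obtain i j where "fst p \<in> layer w U i" "snd p \<in> layer w U (Suc i)"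
      "snd p \<in> layer w U j" "fst p \<in> layer w U (Suc j)"
      unfolding A_def by fastforce
    then have "i = Suc j" "j = Suc i" using same by blast+
    then show False by simp
  qed
  moreover have "sum ?q (prod.swap ` A) = sum ?q A"
    by (subst sum.reindex) (auto simp: sym power2_commute intro!: sum.cong)
  ultimately have "2 * sum ?q A = sum ?q (A \<union> prod.swap ` A)"
    by (subst sum.union_disjoint) auto
  also have "\<dots> \<le> sum ?q UNIV"
    by (intro sum_mono2) (auto simp: nn)
  also have "\<dots> = (\<Sum>v\<in>UNIV. \<Sum>u\<in>UNIV. w v u * (f $ v - f $ u) * (f $ v - f $ u))"
    by (simp add: sum.cartesian_product power2_eq_square algebra_simps flip: UNIV_Times_UNIV)
  also have "\<dots> = 2 * (laplacian w f \<bullet> f)"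
    by (simp add: inner_laplacian [OF w])
  finally show ?thesis using A by simp
qed

text \<open>Cauchy-Schwarz separates the edge energies from the geometric coefficients in the solved
  recurrence. The energies sum to at most the Dirichlet form, whatever \<open>m\<close> is, and the
  squared coefficients are the inner sum in \<open>delta\<close>.\<close>

lemma layer_norm_le:
  fixes w :: "'v::finite \<Rightarrow> 'v \<Rightarrow> real"
  assumes w: "weighted_graph w" and U: "U \<noteq> {}" and m: "m \<le> last_layer w U"
    and vanish: "\<And>u. u \<in> U \<Longrightarrow> f $ u = 0"
  shows "(\<Sum>v\<in>layer w U m. (f $ v)\<^sup>2)
    \<le> (laplacian w f \<bullet> f)
      * (\<Sum>k = 1..m. 1 / K_inf w U (k - 1) * (\<Prod>i = k..<m. D_sup w U i / K_inf w U i))"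
    (is "_ \<le> ?Q * (\<Sum>k = 1..m. ?c k)")
proof -
  let ?K = "K_inf w U" and ?D = "D_sup w U" and ?E = "layer_energy w U f"
  let ?N = "\<lambda>m. L2_set (($) f) (layer w U m)"
  define n where "n = last_layer w U"
  have ne: "layer w U k \<noteq> {}" if "k \<le> n" for k
    using layer_nonempty [OF U] that by (simp add: n_def)
  have K: "0 < ?K k" if "k < n" for k
    using K_inf_pos [OF w ne] that by simp
  have D: "0 \<le> ?D k" if "k < n" for k
    using D_sup_nonneg [OF w ne] that by simp
  have c_nonneg: "0 \<le> ?c k" if "k \<in> {1..m}" for k
    using that m by (intro path_coefficient_nonneg w U) auto
  have "?N m \<le> (\<Sum>k = 1..m. sqrt (?E (k - 1)) / sqrt (?K (k - 1)) * (\<Prod>i = k..<m. sqrt (?D i / ?K i)))"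
  proof (rule linear_recurrence_le [where n = n])
    show "?N 0 \<le> 0" using vanish by (simp add: L2_set_def)
  next
    fix k assume "k < n"
    then show "0 \<le> sqrt (?D k / ?K k)"
      using D [of k] K [of k] by (auto simp: less_imp_le)
  next
    fix k assume "k < n"
    then show "?N (Suc k) \<le> sqrt (?D k / ?K k) * ?N k + sqrt (?E k) / sqrt (?K k)"
      by (intro layer_step w ne) simp
  next
    show "m \<le> n" using m by (simp add: n_def)
  qed
  also have "\<dots> = (\<Sum>k = 1..m. sqrt (?E (k - 1)) * sqrt (?c k))"
    by (simp add: real_sqrt_mult real_sqrt_divide sqrt_prod)
  finally have N: "?N m \<le> (\<Sum>k = 1..m. sqrt (?E (k - 1)) * sqrt (?c k))" .
  have "(\<Sum>v\<in>layer w U m. (f $ v)\<^sup>2) = (?N m)\<^sup>2"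
    by (simp add: L2_set_def sum_nonneg)
  also have "\<dots> \<le> (\<Sum>k = 1..m. sqrt (?E (k - 1)) * sqrt (?c k))\<^sup>2"
    by (intro power_mono N L2_set_nonneg)
  also have "\<dots> \<le> (\<Sum>k = 1..m. (sqrt (?E (k - 1)))\<^sup>2) * (\<Sum>k = 1..m. (sqrt (?c k))\<^sup>2)"
    by (rule Cauchy_Schwarz_ineq_sum)
  also have "\<dots> = (\<Sum>k = 1..m. ?E (k - 1)) * (\<Sum>k = 1..m. ?c k)"
    using c_nonneg by (intro arg_cong2 [where f = "(*)"] sum.cong refl)
      (simp_all add: layer_energy_nonneg w)
  also have "(\<Sum>k = 1..m. ?E (k - 1)) = (\<Sum>k<m. ?E k)"
    by (simp add: sum.atLeast1_atMost_eq)
  also have "\<dots> * (\<Sum>k = 1..m. ?c k) \<le> ?Q * (\<Sum>k = 1..m. ?c k)"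
    by (intro mult_right_mono sum_layer_energy_le w sum_nonneg c_nonneg)
  finally show ?thesis .
qed

text \<open>The layers partition the vertices, so the layer bounds add up. The layer \<open>U\<close> itself, with
  index \<open>0\<close>, contributes nothing; hence the outer sum in \<open>delta\<close> starts at \<open>1\<close>.\<close>

lemma poincare_inequality:
  fixes w :: "'v::finite \<Rightarrow> 'v \<Rightarrow> real"
  assumes w: "weighted_graph w" and cover: "layers_disjoint_cover w U" and U: "U \<noteq> {}"
    and vanish: "\<And>u. u \<in> U \<Longrightarrow> f $ u = 0"
  shows "f \<bullet> f \<le> (delta w U)\<^sup>2 * (laplacian w f \<bullet> f)"
proof -
  let ?n = "last_layer w U" and ?Q = "laplacian w f \<bullet> f"
  let ?c = "\<lambda>m. \<Sum>k = 1..m. 1 / K_inf w U (k - 1) * (\<Prod>i = k..<m. D_sup w U i / K_inf w U i)"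
  have "f \<bullet> f = (\<Sum>v\<in>(\<Union>m\<le>?n. layer w U m). (f $ v)\<^sup>2)"
    using cover by (simp add: layers_disjoint_cover_def inner_vec_def power2_eq_square)
  also have "\<dots> = (\<Sum>m\<le>?n. \<Sum>v\<in>layer w U m. (f $ v)\<^sup>2)"
    by (intro sum.UNION_disjoint) (auto simp: layers_disjoint)
  also have "\<dots> \<le> (\<Sum>m\<le>?n. ?Q * ?c m)"
    by (intro sum_mono layer_norm_le w U vanish) simp_all
  also have "\<dots> = ?Q * (\<Sum>m = 1..?n. ?c m)"
    unfolding atMost_atLeast0 sum.atLeast_Suc_atMost [OF le0] sum_distrib_left by simp
  also have "(\<Sum>m = 1..?n. ?c m) = (delta w U)\<^sup>2"
    using delta_nonneg [OF w U] unfolding delta_def real_sqrt_ge_0_iff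
    by (rule real_sqrt_pow2 [symmetric])
  finally show ?thesis by (simp add: mult.commute)
qed

section \<open>Exact quadrature\<close>

text \<open>On a finite-dimensional space of functions determined by their values on \<open>U\<close>, every linear
  functional is a combination of these values: apply it to the function rebuilt from the
  restriction by a linear left inverse.\<close>

lemma functional_from_values_on_uniqueness_set:
  fixes V :: "(real ^ 'v::finite) set" and h :: "real ^ 'v \<Rightarrow> real"
  assumes V: "subspace V" and h: "linear h"
    and unique: "\<And>f. f \<in> V \<Longrightarrow> (\<And>u. u \<in> U \<Longrightarrow> f $ u = 0) \<Longrightarrow> f = 0"
  obtains \<mu> :: "'v \<Rightarrow> real" where "\<And>f. f \<in> V \<Longrightarrow> h f = (\<Sum>u\<in>U. f $ u * \<mu> u)"
proof -
  define R :: "real ^ 'v \<Rightarrow> real ^ 'v" where "R f = (\<Sum>u\<in>U. (f $ u) *\<^sub>R axis u 1)" for f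
  have R: "linear R"
    by (rule linearI) (simp_all add: R_def sum.distrib scaleR_sum_right algebra_simps)
  have R_nth: "R f $ u = f $ u" if "u \<in> U" for f u
  proof -
    have "R f $ u = (\<Sum>x\<in>U. if x = u then f $ u else 0)"
      unfolding R_def sum_component by (intro sum.cong) (auto simp: axis_def)
    with that show ?thesis by simp
  qed
  have "inj_on R V"
    unfolding linear_inj_on_iff_eq_0 [OF R V]
  proof (intro ballI impI)
    fix f assume "f \<in> V" "R f = 0"
    then show "f = 0" using R_nth [of _ f] by (intro unique) auto
  qed
  then obtain G where G: "linear G" "\<And>f. f \<in> V \<Longrightarrow> G (R f) = f"
    using linear_exists_left_inverse_on [OF R V] by blast
  have hG: "linear (h \<circ> G)" using G(1) h by (rule linear_compose)
  have "h f = (\<Sum>u\<in>U. f $ u * (h \<circ> G) (axis u 1))" if "f \<in> V" for f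
  proof -
    have "h f = (h \<circ> G) (R f)" using G(2) that by simp
    also have "\<dots> = (\<Sum>u\<in>U. f $ u * (h \<circ> G) (axis u 1))"
      unfolding R_def linear_sum [OF hG] linear_cmul [OF hG] by simp
    finally show ?thesis .
  qed
  then show thesis by (rule that)
qed

theorem theorem5p3:
  fixes w :: "'v::finite \<Rightarrow> 'v \<Rightarrow> real" and U :: "'v set" and \<omega> :: real
  assumes "weighted_graph w"
    and "layers_disjoint_cover w U"
    and "\<omega> > 0"
    and "delta w U * sqrt \<omega> < 1"
  shows "\<exists>\<mu> :: 'v \<Rightarrow> real. \<forall>f \<in> spectral_space w \<omega>.
           (\<Sum>v\<in>UNIV. f $ v) = (\<Sum>u\<in>U. f $ u * \<mu> u)"
proof -
  \<comment> \<open>All layers around the empty set are empty, and then they do not cover the vertices.\<close>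
  have U: "U \<noteq> {}"
  proof
    assume "U = {}"
    then have "layer w U m = {}" for m
      by (induction m) (auto elim: layer_Suc_neighbour simp del: layer.simps(2))
    with assms(2) show False by (simp add: layers_disjoint_cover_def)
  qed
  have unique: "f = 0"
    if f: "f \<in> spectral_space w \<omega>" and vanish: "\<And>u. u \<in> U \<Longrightarrow> f $ u = 0" for f
  proof (rule ccontr)
    assume "f \<noteq> 0"
    then have pos: "0 < f \<bullet> f" by simp
    have "f \<bullet> f \<le> (delta w U)\<^sup>2 * (\<omega> * (f \<bullet> f))"
      using poincare_inequality [OF assms(1,2) U vanish]
        mult_left_mono [OF laplacian_bernstein [OF assms(1) f], of "(delta w U)\<^sup>2"]
      by simp
    also have "\<dots> = (delta w U * sqrt \<omega>)\<^sup>2 * (f \<bullet> f)"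
      using assms(3) by (simp add: power_mult_distrib)
    finally have "1 \<le> (delta w U * sqrt \<omega>)\<^sup>2" using pos by simp
    moreover have "0 \<le> delta w U * sqrt \<omega>"
      using delta_nonneg [OF assms(1) U] assms(3) by simp
    ultimately show False
      using assms(4) by (simp add: power_less_one_iff flip: not_less)
  qed
  have V: "subspace (spectral_space w \<omega>)"
    unfolding spectral_space_def by (rule subspace_span)
  have total: "linear (\<lambda>f :: real ^ 'v. \<Sum>v\<in>UNIV. f $ v)"
    by (rule linearI) (simp_all add: sum.distrib sum_distrib_left)
  obtain \<mu> :: "'v \<Rightarrow> real" where
    "\<And>f. f \<in> spectral_space w \<omega> \<Longrightarrow> (\<Sum>v\<in>UNIV. f $ v) = (\<Sum>u\<in>U. f $ u * \<mu> u)"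
    using functional_from_values_on_uniqueness_set [OF V total unique] by blast
  then show ?thesis by blast
qed

end
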